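(* Let $g(n,K_3,\emptyset)$ denote the score of the Constructor-Blocker game on $K_n$ in which Constructor has no restriction (no forbidden subgraph) and the score is the number of triangles in Constructor's graph. Then, as $n\to\infty$, $$g(n,K_3,\emptyset)=(1+o(1))\frac{n^3}{48}.$$
   Context: Constructor-Blocker game: given graphs $H$ and $F$ (or a family $\mathcal{F}$, possibly empty), two players, Constructor and Blocker, alternately claim previously unclaimed edges of the complete graph $K_n$, Constructor moving first. Constructor may only claim an edge if her graph (the edges she has claimed) remains $F$-free (contains no subgraph isomorphic to a member of $\mathcal{F}$); Blocker may claim any unclaimed edge. The game ends when Constructor cannot claim any more edges or all edges are claimed. The score is the number of copies of $H$ in Constructor's graph at the end. Constructor maximizes, Blocker minimizes; $g(n,H,\mathcal{F})$ denotes the score under optimal play by both. With $\mathcal{F}=\emptyset$ there is no restriction on Constructor. *)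

theory Defs
  imports Complex_Main "HOL-Library.Landau_Symbols"
begin

definition Kn_edges :: "nat \<Rightarrow> nat set set" where
  "Kn_edges n = {e. \<exists>x y. x < n \<and> y < n \<and> x \<noteq> y \<and> e = {x, y}}"

definition triangles :: "nat set set \<Rightarrow> nat" where
  "triangles C = card {T :: nat set. card T = 3 \<and>
      (\<forall>x\<in>T. \<forall>y\<in>T. x \<noteq> y \<longrightarrow> {x, y} \<in> C)}"

text \<open>Value of the Constructor-Blocker game under optimal play.
  E: board edges; ok: admissibility of Constructor's graph (F-freeness);
  sc: score of Constructor's final graph; fuel k bounds remaining moves;
  the boolean is True iff it is Constructor's turn; C, B: edges claimed by
  Constructor and Blocker. The game ends as soon as Constructor has no
  legal move (in particular when all edges are claimed).\<close>
fun game_val :: "nat set set \<Rightarrow> (nat set set \<Rightarrow> bool) \<Rightarrow> (nat set set \<Rightarrow> nat)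
    \<Rightarrow> nat \<Rightarrow> bool \<Rightarrow> nat set set \<Rightarrow> nat set set \<Rightarrow> nat" where
  "game_val E ok sc 0 t C B = sc C"
| "game_val E ok sc (Suc k) t C B =
     (if {e \<in> E - C - B. ok (insert e C)} = {} then sc C
      else if t then Max ((\<lambda>e. game_val E ok sc k False (insert e C) B) `
                          {e \<in> E - C - B. ok (insert e C)})
      else Min ((\<lambda>e. game_val E ok sc k True C (insert e B)) ` (E - C - B)))"

text \<open>g(n, K_3, \<emptyset>): no restriction on Constructor, score = number of triangles.
  Each move claims an edge, so card (Kn_edges n) moves suffice as fuel.\<close>
definition g_K3_empty :: "nat \<Rightarrow> nat" where
  "g_K3_empty n = game_val (Kn_edges n) (\<lambda>_. True) triangles (card (Kn_edges n)) True {} {}"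

end

theory Submission
  imports Defs "HOL-Real_Asymp.Real_Asymp"
begin

text \<open>
  Give a triangle that Blocker has not touched the weight \<open>(1/2)^u\<close>, where \<open>u\<close> is the number of its
  unclaimed edges. The total weight is initially \<open>(n choose 3) / 8\<close> and finally equals the score.
  A move by Constructor (Blocker) at an edge adds (subtracts) the weight of the triangles through
  that edge, so both players play greedily. A Blocker move followed by a Constructor move then does
  not increase the total, and only the opening move is unpaired. A Constructor move at \<open>e\<close> followed
  by a Blocker move at \<open>f\<close> costs at most the previous weight of the triangle through \<open>e\<close> and \<open>f\<close>,
  which is at most \<open>1/4\<close>. Hence the score is \<open>(n choose 3) / 8 + O(n^2)\<close>.
\<close>

section \<open>Greedy play in the positional game on a hypergraph\<close>

text \<open>The points are board edges and \<open>H\<close> collects the target sets.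
  \<open>score_eq\<close> is restricted to \<open>C\<close> inside the board because
  \<open>triangles\<close> ranges over triples of arbitrary naturals, while the targets only use
  vertices below \<open>n\<close>.\<close>

locale hypergraph_game =
  fixes E :: "nat set set" and H :: "nat set set set" and score :: "nat set set \<Rightarrow> nat"
  assumes finite_E: "finite E"
    and H_subset: "A \<in> H \<Longrightarrow> A \<subseteq> E"
    and score_eq: "C \<subseteq> E \<Longrightarrow> score C = card {A \<in> H. A \<subseteq> C}"
begin

section \<open>Total weight and its change under a single move\<close>

abbreviation val :: "nat \<Rightarrow> bool \<Rightarrow> nat set set \<Rightarrow> nat set set \<Rightarrow> nat" where
  "val \<equiv> game_val E (\<lambda>_. True) score"

text \<open>The expected final score if every unclaimed edge were given to Constructor or Blocker by
  a fair coin.\<close>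

definition potential :: "nat set set \<Rightarrow> nat set set \<Rightarrow> real" where
  "potential C B = (\<Sum>A | A \<in> H \<and> A \<inter> B = {}. (1/2) ^ card (A - C))"

definition weight :: "nat set set \<Rightarrow> nat set set \<Rightarrow> nat set \<Rightarrow> real" where
  "weight C B e = (\<Sum>A | A \<in> H \<and> A \<inter> B = {} \<and> e \<in> A. (1/2) ^ card (A - C))"

lemma finite_H [simp]: "finite H"
  using finite_subset[of H "Pow E"] finite_E H_subset by auto

lemma finite_if_in_H: "A \<in> H \<Longrightarrow> finite A"
  using H_subset finite_E finite_subset by blast

lemma half_power_card_Diff_insert:
  assumes "A \<in> H" "e \<notin> C"
  shows "(1/2::real) ^ card (A - insert e C) = (if e \<in> A then 2 else 1) * (1/2) ^ card (A - C)"
proof (cases "e \<in> A")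
  case True
  then have "A - C = insert e (A - insert e C)"
    using assms(2) by auto
  then have "card (A - C) = Suc (card (A - insert e C))"
    using finite_if_in_H[OF assms(1)] by (metis Diff_iff card_insert_disjoint finite_Diff insertI1)
  then show ?thesis using True by simp
next
  case False
  then have "A - insert e C = A - C" by auto
  with False show ?thesis by simp
qed

text \<open>Each surviving target through \<open>e\<close> has one missing edge fewer, so its weight
  doubles and the gain equals its old weight.\<close>

lemma potential_insert_Constructor:
  assumes "e \<notin> C"
  shows "potential (insert e C) B = potential C B + weight C B e"
proof -
  have "potential (insert e C) B = (\<Sum>A | A \<in> H \<and> A \<inter> B = {}.
      (1/2) ^ card (A - C) + (if e \<in> A then (1/2) ^ card (A - C) else 0))"
    unfolding potential_def using assms
    by (intro sum.cong) (auto simp: half_power_card_Diff_insert)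
  also have "\<dots> = potential C B + weight C B e"
    unfolding potential_def weight_def sum.distrib
    by (subst sum.inter_filter[symmetric]) (auto intro!: sum.cong)
  finally show ?thesis .
qed

lemma potential_insert_Blocker: "potential C (insert f B) = potential C B - weight C B f"
proof -
  have "{A. A \<in> H \<and> A \<inter> B = {}} =
      {A. A \<in> H \<and> A \<inter> insert f B = {}} \<union> {A. A \<in> H \<and> A \<inter> B = {} \<and> f \<in> A}"
    by auto
  then have "potential C B = potential C (insert f B) + weight C B f"
    unfolding potential_def weight_def
    by (simp only:) (rule sum.union_disjoint, auto)
  then show ?thesis by simp
qed

lemma weight_nonneg: "weight C B e \<ge> 0"
  unfolding weight_def by (intro sum_nonneg) auto

lemma weight_insert_Blocker_le: "weight C (insert f B) e \<le> weight C B e"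
  unfolding weight_def by (intro sum_mono2) auto

text \<open>Only targets containing both \<open>e\<close> and \<open>f\<close> change: their weight
  doubles. Each of them missed at least these two edges before the move, so each adds at most
  \<open>(1/2)^2\<close>.\<close>

lemma weight_insert_Constructor_le:
  assumes "e \<notin> C" "f \<notin> C" "e \<noteq> f" and codegree: "card {A \<in> H. e \<in> A \<and> f \<in> A} \<le> d"
  shows "weight (insert e C) B f \<le> weight C B f + d / 4"
proof -
  let ?S = "{A. A \<in> H \<and> A \<inter> B = {} \<and> f \<in> A}"
  have "weight (insert e C) B f = (\<Sum>A\<in>?S.
      (1/2) ^ card (A - C) + (if e \<in> A then (1/2) ^ card (A - C) else 0))"
    unfolding weight_def using assms
    by (intro sum.cong) (auto simp: half_power_card_Diff_insert)
  also have "\<dots> = weight C B f + (\<Sum>A\<in>{A \<in> ?S. e \<in> A}. (1/2) ^ card (A - C))"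
    unfolding weight_def sum.distrib by (subst sum.inter_filter[symmetric]) auto
  also have "(\<Sum>A\<in>{A \<in> ?S. e \<in> A}. (1/2) ^ card (A - C)) \<le> (\<Sum>A\<in>{A \<in> ?S. e \<in> A}. 1/4::real)"
  proof (intro sum_mono)
    fix A assume A: "A \<in> {A \<in> ?S. e \<in> A}"
    then have "card {e, f} \<le> card (A - C)"
      using assms finite_if_in_H by (intro card_mono) auto
    then have "(1/2::real) ^ card (A - C) \<le> (1/2) ^ 2"
      using assms(3) by (intro power_decreasing) auto
    then show "(1/2::real) ^ card (A - C) \<le> 1/4" by (simp add: power2_eq_square)
  qed
  also have "\<dots> = card {A \<in> ?S. e \<in> A} / 4"
    by simp
  also have "card {A \<in> ?S. e \<in> A} \<le> card {A \<in> H. e \<in> A \<and> f \<in> A}"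
    by (intro card_mono) auto
  finally show ?thesis using codegree by simp
qed

lemma potential_final:
  assumes "E - C - B = {}" "C \<inter> B = {}" "C \<subseteq> E"
  shows "potential C B = score C"
proof -
  have "{A. A \<in> H \<and> A \<inter> B = {}} = {A \<in> H. A \<subseteq> C}"
    using assms H_subset by blast
  moreover have "(\<Sum>A\<in>{A \<in> H. A \<subseteq> C}. (1/2::real) ^ card (A - C)) = (\<Sum>A\<in>{A \<in> H. A \<subseteq> C}. 1)"
  proof (intro sum.cong refl)
    fix A assume "A \<in> {A \<in> H. A \<subseteq> C}"
    then have "A - C = {}" by auto
    then show "(1/2::real) ^ card (A - C) = 1" by (simp only: card.empty power_0)
  qed
  ultimately show ?thesis
    unfolding potential_def using assms(3) by (simp add: score_eq)
qed

section \<open>Greedy play, analysed in rounds of two moves\<close>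

lemma val_Suc_Constructor:
  assumes "E - C - B \<noteq> {}"
  shows "val (Suc k) True C B = Max ((\<lambda>e. val k False (insert e C) B) ` (E - C - B))"
  using assms by (simp only: game_val.simps simp_thms Collect_mem_eq if_False if_True)

lemma val_Suc_Blocker:
  assumes "E - C - B \<noteq> {}"
  shows "val (Suc k) False C B = Min ((\<lambda>e. val k True C (insert e B)) ` (E - C - B))"
  using assms by (simp only: game_val.simps simp_thms Collect_mem_eq if_False if_True)

lemma ex_max_weight:
  assumes "E - C - B \<noteq> {}"
  obtains e where "e \<in> E - C - B" "\<And>f. f \<in> E - C - B \<Longrightarrow> weight C B f \<le> weight C B e"
proof -
  have "Max (weight C B ` (E - C - B)) \<in> weight C B ` (E - C - B)"
    using finite_E assms by (intro Max_in) auto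
  then obtain e where e: "e \<in> E - C - B" "Max (weight C B ` (E - C - B)) = weight C B e"
    by blast
  have "weight C B f \<le> weight C B e" if "f \<in> E - C - B" for f
    unfolding e(2)[symmetric] using finite_E that by (intro Max_ge) auto
  with e(1) show ?thesis by (rule that)
qed

lemma card_free_insert:
  assumes "e \<in> E - C - B"
  shows "card (E - insert e C - B) = card (E - C - B) - 1"
    "card (E - C - insert e B) = card (E - C - B) - 1"
proof -
  have "E - insert e C - B = (E - C - B) - {e}" "E - C - insert e B = (E - C - B) - {e}"
    by auto
  then show "card (E - insert e C - B) = card (E - C - B) - 1"
    "card (E - C - insert e B) = card (E - C - B) - 1"
    using assms finite_E by simp_all
qed

text \<open>Blocker takes a heaviest edge \<open>f\<close>. Blocking can only lower other weights,
  so the reply \<open>e\<close> regains at most \<open>weight C B e\<close>, which is at most the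
  weight just lost. The induction is strong because the hypothesis is applied two moves
  later.\<close>

lemma val_le_potential:
  assumes "C \<inter> B = {}" "C \<subseteq> E" "card (E - C - B) = k"
  shows "val k False C B \<le> potential C B"
  using assms
proof (induction k arbitrary: C B rule: less_induct)
  case (less k)
  show ?case
  proof (cases k)
    case 0
    then show ?thesis
      using less.prems finite_E potential_final[of C B] by simp
  next
    case (Suc k')
    then have "E - C - B \<noteq> {}" using less.prems by force
    then obtain f where f: "f \<in> E - C - B"
      and f_max: "\<And>e. e \<in> E - C - B \<Longrightarrow> weight C B e \<le> weight C B f"
      by (rule ex_max_weight) blast
    have "val k False C B \<le> val k' True C (insert f B)"
      unfolding Suc val_Suc_Blocker[OF \<open>E - C - B \<noteq> {}\<close>]
      using f finite_E by (intro Min_le) auto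
    also have "val k' True C (insert f B) \<le> potential C B"
    proof (cases k')
      \<comment> \<open>Blocker has taken the last edge; there is no reply, and the final score is
        the old total minus a nonnegative weight.\<close>
      case 0
      then have "E - C - insert f B = {}"
        using less.prems(3) Suc card_free_insert(2)[OF f] finite_E by simp
      then have "score C = potential C (insert f B)"
        using potential_final[of C "insert f B"] less.prems f by auto
      then show ?thesis
        using 0 potential_insert_Blocker[of C f B] weight_nonneg[of C B f] by simp
    next
      case (Suc k'')
      have card': "card (E - C - insert f B) = Suc k''"
        using less.prems(3) Suc \<open>k = Suc k'\<close> card_free_insert(2)[OF f] by simp
      then have ne: "E - C - insert f B \<noteq> {}" by force
      \<comment> \<open>An optimal reply \<open>e\<close> of Constructor attains the maximum; the
        estimate below holds for every free edge.\<close>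
      have "val k' True C (insert f B) \<in>
          (\<lambda>e. val k'' False (insert e C) (insert f B)) ` (E - C - insert f B)"
        unfolding Suc val_Suc_Constructor[OF ne] using ne finite_E by (intro Max_in) auto
      then obtain e where e: "e \<in> E - C - insert f B"
        and val_e: "val k' True C (insert f B) = val k'' False (insert e C) (insert f B)"
        by blast
      have "val k'' False (insert e C) (insert f B) \<le> potential (insert e C) (insert f B)"
        using less.prems e f card' card_free_insert(1)[OF e] Suc \<open>k = Suc k'\<close>
        by (intro less.IH) auto
      also have "\<dots> = potential C B - weight C B f + weight C (insert f B) e"
        using e by (subst potential_insert_Constructor) (auto simp: potential_insert_Blocker)
      also have "\<dots> \<le> potential C B"
        using weight_insert_Blocker_le[of C f B e] f_max[of e] e by simp
      finally show ?thesis using val_e by simp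
    qed
    finally show ?thesis by simp
  qed
qed

text \<open>Constructor takes a heaviest edge \<open>e\<close>. The reply \<open>f\<close> destroys
  its weight measured after that move, which exceeds \<open>weight C B f\<close>, hence also
  \<open>weight C B e\<close>, by at most \<open>d / 4\<close>. This excess is the net loss of the
  round.\<close>

lemma val_ge_potential:
  assumes codegree: "\<And>e f. e \<in> E \<Longrightarrow> f \<in> E \<Longrightarrow> e \<noteq> f \<Longrightarrow> card {A \<in> H. e \<in> A \<and> f \<in> A} \<le> d"
    and "C \<inter> B = {}" "C \<subseteq> E" "card (E - C - B) = k"
  shows "potential C B - real k * real d / 4 \<le> val k True C B"
  using assms(2-)
proof (induction k arbitrary: C B rule: less_induct)
  case (less k)
  show ?case
  proof (cases k)
    case 0
    then show ?thesis
      using less.prems finite_E potential_final[of C B] by simp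
  next
    case (Suc k')
    then have "E - C - B \<noteq> {}" using less.prems by force
    then obtain e where e: "e \<in> E - C - B"
      and e_max: "\<And>f. f \<in> E - C - B \<Longrightarrow> weight C B f \<le> weight C B e"
      by (rule ex_max_weight) blast
    have "potential C B - real k * real d / 4 \<le> val k' False (insert e C) B"
    proof (cases k')
      case 0
      then have "E - insert e C - B = {}"
        using less.prems(3) Suc card_free_insert(1)[OF e] finite_E by simp
      then have "score (insert e C) = potential (insert e C) B"
        using potential_final[of "insert e C" B] less.prems e by auto
      then have "val k' False (insert e C) B = potential C B + weight C B e"
        using 0 e potential_insert_Constructor[of e C B] by simp
      moreover have "0 \<le> real k * real d / 4" by simp
      ultimately show ?thesis
        using weight_nonneg[of C B e] by linarith
    next
      case (Suc k'')
      have card': "card (E - insert e C - B) = Suc k''"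
        using less.prems(3) Suc \<open>k = Suc k'\<close> card_free_insert(1)[OF e] by simp
      then have ne: "E - insert e C - B \<noteq> {}" by force
      have "val k' False (insert e C) B \<in>
          (\<lambda>f. val k'' True (insert e C) (insert f B)) ` (E - insert e C - B)"
        unfolding Suc val_Suc_Blocker[OF ne] using ne finite_E by (intro Min_in) auto
      then obtain f where f: "f \<in> E - insert e C - B"
        and val_f: "val k' False (insert e C) B = val k'' True (insert e C) (insert f B)"
        by blast
      have "weight (insert e C) B f \<le> weight C B f + d / 4"
        using e f by (intro weight_insert_Constructor_le codegree) auto
      also have "weight C B f \<le> weight C B e"
        using e_max f by auto
      finally have "potential C B - d / 4 \<le> potential (insert e C) (insert f B)"
        using e by (simp add: potential_insert_Constructor potential_insert_Blocker)
      moreover have "potential (insert e C) (insert f B) - real k'' * real d / 4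
          \<le> val k'' True (insert e C) (insert f B)"
        using less.prems e f card' card_free_insert(2)[OF f] Suc \<open>k = Suc k'\<close>
        by (intro less.IH) auto
      \<comment> \<open>The error term allots \<open>d / 4\<close> to each move, but a round of two
        moves loses only one such amount; the generous allotment avoids a parity
        distinction.\<close>
      moreover have "real k * d / 4 = real k'' * d / 4 + d / 4 + d / 4"
        using Suc \<open>k = Suc k'\<close> by (simp add: field_simps)
      moreover have "0 \<le> real d / 4" by simp
      ultimately show ?thesis using val_f by linarith
    qed
    also have "val k' False (insert e C) B \<le> val k True C B"
      unfolding Suc val_Suc_Constructor[OF \<open>E - C - B \<noteq> {}\<close>]
      using e finite_E by (intro Max_ge) auto
    finally show ?thesis by simp
  qed
qed

section \<open>Bounds from the opening position\<close>

lemma potential_empty: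
  assumes "\<And>A. A \<in> H \<Longrightarrow> card A = r"
  shows "potential {} {} = card H / 2 ^ r"
proof -
  have "potential {} {} = (\<Sum>A\<in>H. (1/2) ^ r)"
    unfolding potential_def using assms by (intro sum.cong) auto
  then show ?thesis by (simp add: power_divide)
qed

lemma weight_empty_le:
  assumes "\<And>A. A \<in> H \<Longrightarrow> card A = r" "card {A \<in> H. e \<in> A} \<le> D"
  shows "weight {} {} e \<le> D / 2 ^ r"
proof -
  have "weight {} {} e = (\<Sum>A\<in>{A \<in> H. e \<in> A}. (1/2) ^ r)"
    unfolding weight_def using assms(1) by (intro sum.cong) auto
  also have "\<dots> = card {A \<in> H. e \<in> A} / 2 ^ r"
    by (simp add: power_divide)
  finally show ?thesis using assms(2) by (simp add: divide_right_mono)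
qed

text \<open>The upper estimate starts with Blocker to move, so the opening edge is split off. It
  raises the total by its initial weight, at most \<open>D / 2 ^ r\<close>.\<close>

lemma game_value_upper:
  assumes uniform: "\<And>A. A \<in> H \<Longrightarrow> card A = r"
    and degree: "\<And>e. e \<in> E \<Longrightarrow> card {A \<in> H. e \<in> A} \<le> D"
  shows "val (card E) True {} {} \<le> (card H + D) / 2 ^ r"
proof (cases "card E")
  case 0
  then show ?thesis
    using potential_final[of "{}" "{}"] potential_empty[OF uniform] finite_E
    by (simp add: add_divide_distrib)
next
  case (Suc k)
  then have ne: "E - {} - {} \<noteq> {}" by auto
  have "val (card E) True {} {} \<in> (\<lambda>e. val k False (insert e {}) {}) ` (E - {} - {})"
    unfolding Suc val_Suc_Constructor[OF ne] using ne finite_E by (intro Max_in) auto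
  then obtain e where e: "e \<in> E" and val_e: "val (card E) True {} {} = val k False {e} {}"
    by auto
  have "val k False {e} {} \<le> potential {e} {}"
    using e Suc finite_E by (intro val_le_potential) auto
  also have "\<dots> = card H / 2 ^ r + weight {} {} e"
    using potential_insert_Constructor[of e "{}" "{}"] potential_empty[OF uniform] by simp
  also have "weight {} {} e \<le> D / 2 ^ r"
    using e by (intro weight_empty_le uniform degree)
  finally show ?thesis using val_e by (simp add: add_divide_distrib)
qed

lemma game_value_lower:
  assumes "\<And>A. A \<in> H \<Longrightarrow> card A = r"
    and "\<And>e f. e \<in> E \<Longrightarrow> f \<in> E \<Longrightarrow> e \<noteq> f \<Longrightarrow> card {A \<in> H. e \<in> A \<and> f \<in> A} \<le> d"
  shows "card H / 2 ^ r - real (card E) * real d / 4 \<le> val (card E) True {} {}"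
  using val_ge_potential[OF assms(2), of "{}" "{}" "card E"] potential_empty[OF assms(1)] by simp

end

section \<open>The hypergraph of triangles\<close>

text \<open>Moves claim edges, so a triangle must enter the hypergraph as the set of its three edges
  rather than as a vertex triple.\<close>

definition pairs :: "nat set \<Rightarrow> nat set set" where
  "pairs T = {e. e \<subseteq> T \<and> card e = 2}"

definition triples :: "nat \<Rightarrow> nat set set" where
  "triples n = {T. T \<subseteq> {..<n} \<and> card T = 3}"

lemma Kn_edges_eq_pairs: "Kn_edges n = pairs {..<n}"
  unfolding Kn_edges_def pairs_def by (auto simp: card_2_iff)

lemma finite_Kn_edges: "finite (Kn_edges n)"
  unfolding Kn_edges_eq_pairs pairs_def by simp

lemma card_Kn_edges: "card (Kn_edges n) = n choose 2"
  unfolding Kn_edges_eq_pairs pairs_def using n_subsets[of "{..<n}" 2] by simp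

lemma card_triples: "card (triples n) = n choose 3"
  unfolding triples_def using n_subsets[of "{..<n}" 3] by simp

lemma card_pairs: "T \<in> triples n \<Longrightarrow> card (pairs T) = 3"
  unfolding triples_def pairs_def
  using n_subsets[of T 2] card.infinite[of T] by (fastforce simp: choose_two)

text \<open>Makes \<open>Union\<close> a left inverse of \<open>pairs\<close>, so counting vertex
  triples and counting hyperedges agree.\<close>

lemma Union_pairs:
  assumes "T \<in> triples n"
  shows "\<Union>(pairs T) = T"
proof -
  obtain x y z where T: "T = {x, y, z}" "x \<noteq> y" "y \<noteq> z" "x \<noteq> z"
    using assms by (auto simp: triples_def card_3_iff)
  then have "{x, y} \<in> pairs T" "{y, z} \<in> pairs T"
    by (auto simp: pairs_def)
  then have "T \<subseteq> \<Union>(pairs T)" using T(1) by blast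
  then show ?thesis by (auto simp: pairs_def)
qed

lemma inj_on_pairs: "inj_on pairs (triples n)"
  by (rule inj_on_inverseI[where g = Union]) (rule Union_pairs)

lemma pairs_subset_iff: "pairs T \<subseteq> C \<longleftrightarrow> (\<forall>x\<in>T. \<forall>y\<in>T. x \<noteq> y \<longrightarrow> {x, y} \<in> C)"
proof
  assume *: "pairs T \<subseteq> C"
  show "\<forall>x\<in>T. \<forall>y\<in>T. x \<noteq> y \<longrightarrow> {x, y} \<in> C"
  proof (intro ballI impI)
    fix x y assume "x \<in> T" "y \<in> T" "x \<noteq> y"
    then have "{x, y} \<in> pairs T" by (simp add: pairs_def)
    with * show "{x, y} \<in> C" ..
  qed
qed (auto simp: pairs_def card_2_iff)

lemma triangles_eq_card_pairs:
  assumes "C \<subseteq> Kn_edges n"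
  shows "triangles C = card {A \<in> pairs ` triples n. A \<subseteq> C}"
proof -
  \<comment> \<open>Every vertex of \<open>T\<close> lies on an edge of \<open>C\<close>, hence is
    below \<open>n\<close>.\<close>
  have "T \<in> triples n" if T3: "card T = 3" and TC: "pairs T \<subseteq> C" for T
  proof -
    obtain x y z where T: "T = {x, y, z}" "x \<noteq> y" "y \<noteq> z" "x \<noteq> z"
      using T3 by (auto simp: card_3_iff)
    then have "{x, y} \<in> pairs T" "{y, z} \<in> pairs T"
      by (auto simp: pairs_def)
    then have "{x, y} \<in> pairs {..<n}" "{y, z} \<in> pairs {..<n}"
      using TC assms Kn_edges_eq_pairs by blast+
    then show ?thesis using T(1) T3 by (auto simp: triples_def pairs_def)
  qed
  then have "triangles C = card {T \<in> triples n. pairs T \<subseteq> C}"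
    unfolding triangles_def pairs_subset_iff[symmetric]
    by (intro arg_cong[where f = card]) (auto simp: triples_def)
  also have "\<dots> = card (pairs ` {T \<in> triples n. pairs T \<subseteq> C})"
    by (intro card_image[symmetric] inj_on_subset[OF inj_on_pairs[of n]]) auto
  also have "pairs ` {T \<in> triples n. pairs T \<subseteq> C} = {A \<in> pairs ` triples n. A \<subseteq> C}"
    by auto
  finally show ?thesis .
qed

text \<open>A triangle through \<open>e\<close> is determined by its third vertex. The crude count
  \<open>n\<close> is enough, as it only bounds the effect of the opening move.\<close>

lemma degree_triangles_le: "card {A \<in> pairs ` triples n. e \<in> A} \<le> n"
proof -
  have "{A \<in> pairs ` triples n. e \<in> A} \<subseteq> (\<lambda>z. pairs (insert z e)) ` {..<n}"
  proof safe
    fix T assume T: "T \<in> triples n" "e \<in> pairs T"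
    then have e: "e \<subseteq> T" "card e = 2" and "card T = 3"
      by (auto simp: pairs_def triples_def)
    then have "card (T - e) = 1"
      by (subst card_Diff_subset) (auto intro: card_ge_0_finite)
    then obtain z where "T - e = {z}" by (auto simp: card_1_singleton_iff)
    then have "T = insert z e" "z < n" using e T(1) by (auto simp: triples_def)
    then show "pairs T \<in> (\<lambda>z. pairs (insert z e)) ` {..<n}" by auto
  qed
  from card_mono[OF _ this] have "card {A \<in> pairs ` triples n. e \<in> A}
      \<le> card ((\<lambda>z. pairs (insert z e)) ` {..<n})"
    by simp
  also have "\<dots> \<le> n"
    using card_image_le[of "{..<n}"] by simp
  finally show ?thesis .
qed

text \<open>Two distinct edges of a triangle already cover its three vertices, so the triple can
  only be \<open>e \<union> f\<close>.\<close>

lemma codegree_triangles_le: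
  assumes "e \<noteq> f"
  shows "card {A \<in> pairs ` triples n. e \<in> A \<and> f \<in> A} \<le> 1"
proof -
  have "{A \<in> pairs ` triples n. e \<in> A \<and> f \<in> A} \<subseteq> {pairs (e \<union> f)}"
  proof
    fix A assume "A \<in> {A \<in> pairs ` triples n. e \<in> A \<and> f \<in> A}"
    then obtain T where T: "A = pairs T" "T \<in> triples n" "e \<in> pairs T" "f \<in> pairs T"
      by auto
    then have ef: "e \<subseteq> T" "f \<subseteq> T" "card e = 2" "card f = 2" and "card T = 3" "finite T"
      by (auto simp: pairs_def triples_def finite_subset[of T "{..<n}"])
    then have "finite e" by (meson finite_subset)
    \<comment> \<open>Distinct sets of equal size are not nested; hence the union has more than two
      elements and fills \<open>T\<close>.\<close>
    then have "\<not> f \<subseteq> e"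
      using assms card_subset_eq[of e f] ef by auto
    then have "e \<subset> e \<union> f" by auto
    then have "card e < card (e \<union> f)"
      using ef \<open>finite T\<close> by (intro psubset_card_mono) (auto dest: finite_subset)
    then have "e \<union> f = T"
      using ef \<open>finite T\<close> \<open>card T = 3\<close> by (intro card_seteq) auto
    then show "A \<in> {pairs (e \<union> f)}" using T(1) by simp
  qed
  from card_mono[OF _ this] show ?thesis by simp
qed

section \<open>The value of the triangle game\<close>

lemma triangle_game: "hypergraph_game (Kn_edges n) (pairs ` triples n) triangles"
proof
  show "A \<subseteq> Kn_edges n" if "A \<in> pairs ` triples n" for A
    using that unfolding Kn_edges_eq_pairs by (auto simp: pairs_def triples_def)
qed (simp_all add: finite_Kn_edges triangles_eq_card_pairs)

lemma g_K3_empty_bounds: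
  shows "real (g_K3_empty n) \<le> (real (n choose 3) + n) / 8"
    and "real (n choose 3) / 8 - real (n choose 2) / 4 \<le> g_K3_empty n"
proof -
  interpret hypergraph_game "Kn_edges n" "pairs ` triples n" triangles
    by (rule triangle_game)
  have uniform: "card A = 3" if "A \<in> pairs ` triples n" for A
    using that card_pairs by auto
  have card_H: "card (pairs ` triples n) = n choose 3"
    by (simp add: card_image[OF inj_on_pairs] card_triples)
  show "real (g_K3_empty n) \<le> (real (n choose 3) + n) / 8"
    \<comment> \<open>The parameters are \<open>r = 3\<close> and \<open>D = n\<close> here, and
      \<open>r = 3\<close> and \<open>d = 1\<close> for the lower bound.\<close>
    using game_value_upper[OF uniform degree_triangles_le]
    by (simp add: g_K3_empty_def card_H)
  show "real (n choose 3) / 8 - real (n choose 2) / 4 \<le> g_K3_empty n"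
    using game_value_lower[OF uniform codegree_triangles_le]
    by (simp add: g_K3_empty_def card_H card_Kn_edges)
qed

theorem theorem1p1:
  shows "(\<lambda>n. real (g_K3_empty n)) \<sim>[at_top] (\<lambda>n. real n ^ 3 / 48)"
proof (rule asymp_equivI')
  \<comment> \<open>The closed forms use real subtraction, so they also hold for small
    \<open>n\<close> and turn both bounds into rational functions with leading term
    \<open>n^3 / 48\<close> before normalization.\<close>
  have choose2: "real (n choose 2) = real n * (real n - 1) / 2" for n
    by (simp add: binomial_gbinomial gbinomial_prod_rev numeral_2_eq_2)
  have choose3: "real (n choose 3) = real n * (real n - 1) * (real n - 2) / 6" for n
    by (simp add: binomial_gbinomial gbinomial_prod_rev numeral_3_eq_3)
  show "(\<lambda>n. real (g_K3_empty n) / (real n ^ 3 / 48)) \<longlonglongrightarrow> 1"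
  proof (rule tendsto_sandwich)
    show "\<forall>\<^sub>F n in sequentially. (real (n choose 3) / 8 - real (n choose 2) / 4) / (real n ^ 3 / 48)
        \<le> real (g_K3_empty n) / (real n ^ 3 / 48)"
      \<comment> \<open>Monotonicity of division only needs a nonnegative denominator, so
        \<open>n = 0\<close>, where the quotients are 0 by convention, is no exception.\<close>
      by (intro always_eventually allI divide_right_mono g_K3_empty_bounds) simp
    show "\<forall>\<^sub>F n in sequentially. real (g_K3_empty n) / (real n ^ 3 / 48)
        \<le> ((real (n choose 3) + n) / 8) / (real n ^ 3 / 48)"
      by (intro always_eventually allI divide_right_mono g_K3_empty_bounds) simp
  qed (unfold choose2 choose3, real_asymp+)
qed

end
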